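(* Let $N\ge 1$, let $\mathcal V\subset\mathbb C$ be a region (connected open set), and let $W:\mathcal V\to\mathbb C^N$ be a holomorphic mapping which is a solution in $\mathcal V$ of the equation $$W'(z)=F(W(z),z),$$ where $F$ is a $\mathbb C^N$-valued holomorphic mapping in a neighbourhood (in $\mathbb C^N\times\mathbb C$) of $\operatorname{graph}(W)=\{(W(z),z): z\in\mathcal V\}$. Let $z_\infty\in\partial\mathcal V$, and suppose that there exists a sequence $\{z_n\}\subset\mathcal V$ with $z_n\to z_\infty$ such that, setting $W_n:=W(z_n)$, one has $\lim_{n\to\infty}W_n=W_\infty\in\mathbb C^N$, and that $F$ is holomorphic at $(W_\infty,z_\infty)$ (that is, $F$ is a single-valued holomorphic mapping on an open set containing both $\operatorname{graph}(W)$ and the point $(W_\infty,z_\infty)$). Then $W$ admits analytical continuation up to $z_\infty$.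
   Context: "$W$ admits analytical continuation up to $z_\infty$" means: there exist an open disc $D\subset\mathbb C$ containing $z_\infty$, an index $n$ with $z_n\in D$, and a holomorphic mapping $S:D\to\mathbb C^N$ such that $S=W$ in a neighbourhood of $z_n$. *)

theory Defs
  imports "HOL-Complex_Analysis.Complex_Analysis"
begin

text \<open>
  Holomorphy of a mapping of several complex variables: it is differentiable at every point of
  the set and the derivative, a priori only real-linear, is complex-linear. Complex scaling on
  the product \<open>(complex ^ 'n) \<times> complex\<close> is written out, because \<open>*\<^sub>R\<close> is the only scaling the
  library provides there. The definition is meant for open sets.
\<close>

definition holomorphic_map_on ::
    "((complex ^ 'n) \<times> complex \<Rightarrow> complex ^ 'm) \<Rightarrow> ((complex ^ 'n) \<times> complex) set \<Rightarrow> bool"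
    (infixl "holomorphic'_map'_on" 50) where
  "F holomorphic_map_on U \<longleftrightarrow>
     (\<forall>p\<in>U. \<exists>L. (F has_derivative L) (at p) \<and>
        (\<forall>c v w. L (c *s v, c * w) = c *s L (v, w)))"

definition holomorphic_curve_on :: "(complex \<Rightarrow> complex ^ 'n) \<Rightarrow> complex set \<Rightarrow> bool"
    (infixl "holomorphic'_curve'_on" 50) where
  "W holomorphic_curve_on V \<longleftrightarrow> (\<forall>i. (\<lambda>z. W z $ i) holomorphic_on V)"

definition curve_deriv :: "(complex \<Rightarrow> complex ^ 'n) \<Rightarrow> complex \<Rightarrow> complex ^ 'n" where
  "curve_deriv W z = (\<chi> i. deriv (\<lambda>w. W w $ i) z)"

text \<open>
  Continuation of \<open>W\<close>, given on \<open>V\<close>, along the sequence \<open>zs\<close> up to its limit \<open>z\<^sub>0\<close>. The disc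
  \<open>ball c r\<close> need not be centred at \<open>z\<^sub>0\<close>. Values of \<open>W\<close> outside \<open>V\<close> are irrelevant, so the
  neighbourhood where \<open>S\<close> and \<open>W\<close> agree is taken inside \<open>V\<close>.
\<close>

definition admits_analytic_continuation_up_to ::
    "(complex \<Rightarrow> complex ^ 'n) \<Rightarrow> complex set \<Rightarrow> (nat \<Rightarrow> complex) \<Rightarrow> complex \<Rightarrow> bool" where
  "admits_analytic_continuation_up_to W V zs z\<^sub>0 \<longleftrightarrow>
     (\<exists>c r n S. z\<^sub>0 \<in> ball c r \<and> zs n \<in> ball c r \<and> S holomorphic_curve_on ball c r \<and>
        (\<exists>T. open T \<and> zs n \<in> T \<and> T \<subseteq> V \<inter> ball c r \<and> (\<forall>z\<in>T. S z = W z)))"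

end

theory Submission
  imports Defs
begin

text \<open>
  Near \<open>(W\<^sub>\<infinity>, z\<^sub>\<infinity>)\<close> the right-hand side \<open>F\<close> is bounded and Lipschitz. The Cauchy problem
  \<open>S' = F (S, z)\<close>, \<open>S z\<^sub>0 = w\<^sub>0\<close> is therefore solvable on a disc about \<open>z\<^sub>0\<close> whose radius depends
  only on the bounds for \<open>F\<close>, hence is the same for all \<open>(w\<^sub>0, z\<^sub>0)\<close> close to
  \<open>(W\<^sub>\<infinity>, z\<^sub>\<infinity>)\<close>. For \<open>w\<^sub>0 = W (z\<^sub>n)\<close>, \<open>z\<^sub>0 = z\<^sub>n\<close> with \<open>n\<close> large this disc contains \<open>z\<^sub>\<infinity>\<close>,
  and the solution on it equals \<open>W\<close> near \<open>z\<^sub>n\<close> by uniqueness.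

  The Lipschitz bound comes from Cauchy's inequality for the restrictions of \<open>F\<close> to complex lines
  (\<open>holomorphic_map_locally_Lipschitz\<close>). Existence (\<open>picard_existence\<close>) and uniqueness
  (\<open>picard_uniqueness\<close>) both rest on \<open>picard_contraction\<close>: a Picard step at least halves
  the sup distance. The Picard iterates are obtained by taking primitives on the disc, which keeps
  them holomorphic.
\<close>

section \<open>Curves with a complex derivative\<close>

text \<open>
  That a curve \<open>S\<close> has complex derivative \<open>d\<close> at \<open>z\<close> is written
  \<open>(S has_derivative (\<lambda>h. h *s d)) (at z)\<close>, so that the mean value inequality and the chain rule
  for Frechet derivatives apply to it directly.
\<close>

lemma norm_vector_scalar_mult: "norm (c *s v) = norm c * norm v"
  for v :: "complex ^ 'n"
  by (simp add: norm_vec_def norm_mult L2_set_right_distrib)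

lemma bounded_linear_vector_scalar_mult: "bounded_linear (\<lambda>h. h *s d)"
  for d :: "complex ^ 'n"
proof (rule bounded_linear_intro[where K = "norm d"])
  show "(x + y) *s d = x *s d + y *s d" for x y
    by (simp add: vec_eq_iff algebra_simps)
  show "(k *\<^sub>R x) *s d = k *\<^sub>R (x *s d)" for k x
    by (simp add: vec_eq_iff)
  show "norm (x *s d) \<le> norm x * norm d" for x
    by (simp add: norm_vector_scalar_mult)
qed

lemma has_derivative_curve_iff:
  fixes S :: "complex \<Rightarrow> complex ^ 'n"
  shows "(S has_derivative (\<lambda>h. h *s d)) (at z) \<longleftrightarrow>
    (\<forall>i. ((\<lambda>w. S w $ i) has_field_derivative d $ i) (at z))"
proof
  assume S: "(S has_derivative (\<lambda>h. h *s d)) (at z)"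
  show "\<forall>i. ((\<lambda>w. S w $ i) has_field_derivative d $ i) (at z)"
  proof
    fix i
    show "((\<lambda>w. S w $ i) has_field_derivative d $ i) (at z)"
      using bounded_linear.has_derivative[OF bounded_linear_vec_nth S, of i]
      by (simp add: has_field_derivative_def mult_commute_abs)
  qed
next
  assume comp: "\<forall>i. ((\<lambda>w. S w $ i) has_field_derivative d $ i) (at z)"
  have "((\<lambda>y. (1 / norm (y - z)) *\<^sub>R (S y - (S z + (y - z) *s d))) \<longlongrightarrow> 0) (at z)"
  proof (rule vec_tendstoI)
    fix i
    have "((\<lambda>w. S w $ i) has_derivative (\<lambda>h. d $ i * h)) (at z)"
      using comp by (simp add: has_field_derivative_def)
    then show "((\<lambda>y. ((1 / norm (y - z)) *\<^sub>R (S y - (S z + (y - z) *s d))) $ i) \<longlongrightarrow> 0 $ i) (at z)"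
      by (simp add: has_derivative_within mult.commute[of "d $ i"] left_diff_distrib)
  qed
  then show "(S has_derivative (\<lambda>h. h *s d)) (at z)"
    by (simp add: has_derivative_within bounded_linear_vector_scalar_mult)
qed

lemma holomorphic_curve_onI:
  assumes "\<And>z. z \<in> B \<Longrightarrow> (S has_derivative (\<lambda>h. h *s d z)) (at z)"
  shows "S holomorphic_curve_on B"
  unfolding holomorphic_curve_on_def
proof
  fix i
  have "((\<lambda>w. S w $ i) has_field_derivative d z $ i) (at z within B)" if "z \<in> B" for z
    using assms[OF that] has_derivative_curve_iff DERIV_subset by blast
  then show "(\<lambda>z. S z $ i) holomorphic_on B"
    by (auto simp: holomorphic_on_def field_differentiable_def)
qed

lemma holomorphic_curve_has_derivative:
  assumes "S holomorphic_curve_on B" "open B" "z \<in> B"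
  shows "(S has_derivative (\<lambda>h. h *s curve_deriv S z)) (at z)"
  using assms unfolding has_derivative_curve_iff holomorphic_curve_on_def curve_deriv_def
  by (auto intro: holomorphic_derivI)

lemma has_derivative_map_along_curve:
  assumes S: "(S has_derivative (\<lambda>h. h *s d)) (at z)"
    and g: "(g has_field_derivative e) (at z)"
    and F: "(F has_derivative L) (at (S z, g z))"
    and L: "\<And>c v w. L (c *s v, c * w) = c *s L (v, w)"
  shows "((\<lambda>z. F (S z, g z)) has_derivative (\<lambda>h. h *s L (d, e))) (at z)"
proof -
  have "((\<lambda>z. (S z, g z)) has_derivative (\<lambda>h. (h *s d, h * e))) (at z)"
    using has_derivative_Pair[OF S, of g "(*) e"] g
    by (simp add: has_field_derivative_def mult.commute[of e])
  from has_derivative_compose[OF this, of F L] F show ?thesis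
    by (simp add: L)
qed

lemma curve_primitive:
  fixes S :: "complex \<Rightarrow> complex ^ 'n"
  assumes "S holomorphic_curve_on B" "convex B" "open B"
  obtains T where "T z0 = w0" "\<And>z. z \<in> B \<Longrightarrow> (T has_derivative (\<lambda>h. h *s S z)) (at z)"
proof -
  have "\<exists>G. \<forall>z\<in>B. (G has_field_derivative S z $ i) (at z)" for i
  proof -
    have "(\<lambda>z. S z $ i) holomorphic_on B"
      using assms(1) by (simp add: holomorphic_curve_on_def)
    from holomorphic_convex_primitive'[OF assms(2,3) this] show ?thesis
      using at_within_open[OF _ assms(3)] by metis
  qed
  then obtain G where G: "\<And>i z. z \<in> B \<Longrightarrow> (G i has_field_derivative S z $ i) (at z)"
    by metis
  let ?T = "\<lambda>z. \<chi> i. G i z - G i z0 + w0 $ i"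
  show ?thesis
  proof (rule that[of ?T])
    show "?T z0 = w0"
      by (simp add: vec_eq_iff)
    show "(?T has_derivative (\<lambda>h. h *s S z)) (at z)" if "z \<in> B" for z
      unfolding has_derivative_curve_iff
      using G[OF that] by (auto intro!: derivative_eq_intros)
  qed
qed

lemma curve_mean_value_bound:
  fixes S :: "complex \<Rightarrow> complex ^ 'n"
  assumes "\<And>z. z \<in> ball z0 s \<Longrightarrow> (S has_derivative (\<lambda>h. h *s d z)) (at z)"
    and "\<And>z. z \<in> ball z0 s \<Longrightarrow> norm (d z) \<le> m"
    and "z \<in> ball z0 s"
  shows "norm (S z - S z0) \<le> s * m"
proof -
  have s: "0 < s" using assms(3) by (metis ball_eq_empty empty_iff not_le)
  have m: "0 \<le> m" using assms(2,3) norm_ge_zero order_trans by blast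
  have "norm (S z - S z0) \<le> m * norm (z - z0)"
  proof (rule differentiable_bound[of "ball z0 s" S "\<lambda>z h. h *s d z"])
    show "(S has_derivative (\<lambda>h. h *s d x)) (at x within ball z0 s)" if "x \<in> ball z0 s" for x
      using assms(1)[OF that] by (rule has_derivative_at_withinI)
    show "onorm (\<lambda>h. h *s d x) \<le> m" if "x \<in> ball z0 s" for x
    proof (rule onorm_bound[OF m])
      show "norm (h *s d x) \<le> m * norm h" for h
        using mult_right_mono[OF assms(2)[OF that], of "norm h"]
        by (simp add: norm_vector_scalar_mult mult.commute)
    qed
  qed (use assms s in auto)
  also have "\<dots> \<le> m * s"
    using assms(3) m by (intro mult_left_mono) (auto simp: dist_norm norm_minus_commute)
  finally show ?thesis by (simp add: mult.commute)
qed

section \<open>Local Lipschitz bounds for holomorphic maps\<close>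

text \<open>
  The restriction of \<open>F\<close> to the complex line through \<open>p\<close> in direction \<open>u\<close> is holomorphic on a disc
  of radius \<open>R / norm u\<close> if \<open>u \<noteq> 0\<close>, and \<open>D u\<close> is its derivative at \<open>0\<close>. The factor \<open>CARD('m)\<close> arises because
  Cauchy's inequality is applied to each component.
\<close>

lemma holomorphic_map_derivative_bound:
  fixes F :: "(complex ^ 'n) \<times> complex \<Rightarrow> complex ^ 'm"
  assumes F: "F holomorphic_map_on U" and R: "0 < R" "cball p R \<subseteq> U"
    and bound: "\<And>q. q \<in> cball p R \<Longrightarrow> norm (F q) \<le> M"
    and D: "(F has_derivative D) (at p)"
  shows "norm (D u) \<le> real CARD('m) * (M / R) * norm u"
proof (cases "u = 0")
  case True
  then show ?thesis
    using D by (simp add: has_derivative_bounded_linear linear_0 bounded_linear.linear)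
next
  case False
  obtain v w where u: "u = (v, w)" by (cases u)
  define \<rho> where "\<rho> = R / norm u"
  have \<rho>: "0 < \<rho>" using R False by (simp add: \<rho>_def)
  define S where "S = (\<lambda>t. fst p + t *s v)"
  define g where "g = (\<lambda>t. snd p + t * w)"
  have on_line: "norm ((S t, g t) - p) = norm t * norm u" for t
  proof -
    have "(S t, g t) - p = (t *s v, t * w)"
      by (simp add: S_def g_def prod_eq_iff)
    then show ?thesis
      by (simp add: u norm_Pair norm_vector_scalar_mult norm_mult power_mult_distrib
          real_sqrt_mult flip: distrib_left)
  qed
  have in_cball: "(S t, g t) \<in> cball p R" if "norm t \<le> \<rho>" for t
  proof -
    have "norm t * norm u \<le> R"
      using that False by (simp add: \<rho>_def pos_le_divide_eq)
    then show ?thesis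
      using on_line[of t] by (simp add: dist_norm norm_minus_commute)
  qed
  have S: "(S has_derivative (\<lambda>h. h *s v)) (at t)" for t
    unfolding has_derivative_curve_iff S_def by (auto intro!: derivative_eq_intros)
  have g: "(g has_field_derivative w) (at t)" for t
    unfolding g_def by (auto intro!: derivative_eq_intros)
  have "\<exists>L. (F has_derivative L) (at q) \<and> (\<forall>c v w. L (c *s v, c * w) = c *s L (v, w))"
    if "q \<in> cball p R" for q
    using F R(2) that unfolding holomorphic_map_on_def by blast
  then obtain L where L: "\<And>q. q \<in> cball p R \<Longrightarrow> (F has_derivative L q) (at q)"
    and L_scale: "\<And>q c v w. q \<in> cball p R \<Longrightarrow> L q (c *s v, c * w) = c *s L q (v, w)"
    by metis
  have deriv: "((\<lambda>t. F (S t, g t)) has_derivative (\<lambda>h. h *s L (S t, g t) u)) (at t)"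
    if "norm t \<le> \<rho>" for t
    unfolding u using has_derivative_map_along_curve[OF S g L L_scale] in_cball[OF that] by blast
  have comp: "norm (D u $ i) \<le> M / R * norm u" for i
  proof -
    have der: "((\<lambda>t. F (S t, g t) $ i) has_field_derivative L (S t, g t) u $ i) (at t)"
      if "norm t \<le> \<rho>" for t
      using deriv[OF that] by (simp add: has_derivative_curve_iff)
    have p: "(S 0, g 0) = p"
      by (simp add: S_def g_def)
    have "L p = D"
      using has_derivative_unique[OF L D] R by simp
    then have D_eq: "deriv (\<lambda>t. F (S t, g t) $ i) 0 = D u $ i"
      using DERIV_imp_deriv[OF der[of 0]] \<rho> p by simp
    have "norm ((deriv ^^ 1) (\<lambda>t. F (S t, g t) $ i) 0) \<le> fact 1 * M / \<rho> ^ 1"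
    proof (rule Cauchy_inequality[where r = \<rho>])
      show "0 < \<rho>" by (rule \<rho>)
      show "(\<lambda>t. F (S t, g t) $ i) holomorphic_on ball 0 \<rho>"
        unfolding holomorphic_on_def field_differentiable_def
      proof (intro ballI exI)
        fix t :: complex assume "t \<in> ball 0 \<rho>"
        then show "((\<lambda>t. F (S t, g t) $ i) has_field_derivative L (S t, g t) u $ i)
            (at t within ball 0 \<rho>)"
          by (intro has_field_derivative_at_within[OF der]) simp
      qed
      show "continuous_on (cball 0 \<rho>) (\<lambda>t. F (S t, g t) $ i)"
      proof (rule continuous_at_imp_continuous_on, rule ballI)
        fix t :: complex assume "t \<in> cball 0 \<rho>"
        then show "isCont (\<lambda>t. F (S t, g t) $ i) t"
          by (intro DERIV_isCont[OF der]) simp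
      qed
      show "norm (F (S t, g t) $ i) \<le> M" if "norm (0 - t) = \<rho>" for t
      proof -
        have "norm (F (S t, g t) $ i) \<le> norm (F (S t, g t))"
          by (rule Finite_Cartesian_Product.norm_nth_le)
        also have "\<dots> \<le> M"
          using that by (intro bound in_cball) simp
        finally show ?thesis .
      qed
    qed
    then show ?thesis
      using D_eq by (simp add: \<rho>_def)
  qed
  have "norm (D u) \<le> (\<Sum>i\<in>UNIV. norm (D u $ i))"
    unfolding norm_vec_def by (rule L2_set_le_sum) simp
  also have "\<dots> \<le> real CARD('m) * (M / R * norm u)"
    using sum_bounded_above[of UNIV "\<lambda>i. norm (D u $ i)" "M / R * norm u", OF comp] by simp
  finally show ?thesis by (simp add: mult.assoc)
qed

lemma holomorphic_map_locally_Lipschitz: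
  fixes F :: "(complex ^ 'n) \<times> complex \<Rightarrow> complex ^ 'm"
  assumes F: "F holomorphic_map_on U" and "open U" "p \<in> U"
  obtains R M L where "0 < R" "0 < M" "0 < L" "cball p R \<subseteq> U"
    "\<And>q. q \<in> cball p R \<Longrightarrow> norm (F q) \<le> M"
    "\<And>q q'. q \<in> cball p R \<Longrightarrow> q' \<in> cball p R \<Longrightarrow> norm (F q - F q') \<le> L * norm (q - q')"
proof -
  obtain R2 where R2: "0 < R2" "cball p R2 \<subseteq> U"
    using assms(2,3) open_contains_cball by blast
  have "continuous_on (cball p R2) F"
  proof (rule continuous_at_imp_continuous_on, rule ballI)
    fix q assume "q \<in> cball p R2"
    then obtain D where "(F has_derivative D) (at q)"
      using F R2(2) unfolding holomorphic_map_on_def by blast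
    then show "isCont F q" by (rule has_derivative_continuous)
  qed
  then have "bounded (F ` cball p R2)"
    by (intro compact_imp_bounded compact_continuous_image) auto
  then obtain M where M: "0 < M" "\<And>q. q \<in> cball p R2 \<Longrightarrow> norm (F q) \<le> M"
    unfolding bounded_pos by blast
  define R where "R = R2 / 2"
  have R: "0 < R" using R2 by (simp add: R_def)
  \<comment> \<open>Balls of radius \<open>R\<close> about points of \<open>cball p R\<close> stay in \<open>cball p R2\<close>, where \<open>M\<close> bounds \<open>F\<close>.\<close>
  have sub: "cball q R \<subseteq> cball p R2" if "q \<in> cball p R" for q
  proof
    fix x assume "x \<in> cball q R"
    then show "x \<in> cball p R2"
      using that dist_triangle[of p x q] by (simp add: R_def)
  qed
  define L where "L = real CARD('m) * (M / R)"
  have L: "0 < L" using M(1) R by (simp add: L_def)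
  have Lip: "norm (F q - F q') \<le> L * norm (q - q')" if q: "q \<in> cball p R" "q' \<in> cball p R" for q q'
  proof -
    have "\<exists>D. (F has_derivative D) (at x)" if "x \<in> cball p R" for x
    proof -
      have "x \<in> U" using sub[OF that] R R2(2) by (meson centre_in_cball less_imp_le subsetD)
      then show ?thesis using F unfolding holomorphic_map_on_def by blast
    qed
    then obtain D where D: "\<And>x. x \<in> cball p R \<Longrightarrow> (F has_derivative D x) (at x)"
      by metis
    show ?thesis
    proof (rule differentiable_bound[of "cball p R" F D])
      show "(F has_derivative D x) (at x within cball p R)" if "x \<in> cball p R" for x
        using D[OF that] by (rule has_derivative_at_withinI)
      show "onorm (D x) \<le> L" if x: "x \<in> cball p R" for x
      proof (rule onorm_bound)
        show "norm (D x u) \<le> L * norm u" for u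
          unfolding L_def
          by (rule holomorphic_map_derivative_bound[OF F R _ _ D[OF x]])
            (use sub[OF x] R2(2) M(2) in blast)+
      qed (use L in simp)
    qed (use q in auto)
  qed
  show ?thesis
  proof (rule that[OF R M(1) L _ _ Lip])
    show "cball p R \<subseteq> U"
      using R2 by (force simp: R_def)
    show "norm (F q) \<le> M" if "q \<in> cball p R" for q
      using that R2 by (intro M(2)) (simp add: R_def)
  qed
qed

section \<open>The Cauchy problem on a disc\<close>

text \<open>
  The closed ball \<open>cball w0 a\<close> confines the values of the curves, \<open>ball z0 r\<close> is the disc of the
  independent variable. The bound \<open>r * M \<le> a\<close> keeps Picard iterates inside the cylinder, and
  \<open>r * L \<le> 1 / 2\<close> makes the Picard step a contraction. Holomorphy on the
  cylinder, which is not open, means that \<open>F\<close>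
  has a complex-linear derivative, in the full neighbourhood sense, at each of its points.
\<close>

locale picard_cylinder =
  fixes F :: "(complex ^ 'n) \<times> complex \<Rightarrow> complex ^ 'n"
    and w0 :: "complex ^ 'n" and z0 :: complex and a r M L :: real
  assumes a: "0 < a" and r: "0 < r"
    and hol: "F holomorphic_map_on (cball w0 a \<times> ball z0 r)"
    and bound: "\<And>w z. w \<in> cball w0 a \<Longrightarrow> z \<in> ball z0 r \<Longrightarrow> norm (F (w, z)) \<le> M"
    and Lipschitz: "\<And>w w' z. w \<in> cball w0 a \<Longrightarrow> w' \<in> cball w0 a \<Longrightarrow> z \<in> ball z0 r \<Longrightarrow>
      norm (F (w, z) - F (w', z)) \<le> L * norm (w - w')"
    and L: "0 \<le> L"
    and rM: "r * M \<le> a" and rL: "r * L \<le> 1 / 2"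
begin

lemma picard_contraction:
  assumes s: "s \<le> r"
    and S: "S ` ball z0 s \<subseteq> cball w0 a" and T: "T ` ball z0 s \<subseteq> cball w0 a"
    and S': "\<And>z. z \<in> ball z0 s \<Longrightarrow> (S' has_derivative (\<lambda>h. h *s F (S z, z))) (at z)"
    and T': "\<And>z. z \<in> ball z0 s \<Longrightarrow> (T' has_derivative (\<lambda>h. h *s F (T z, z))) (at z)"
    and eq: "S' z0 = T' z0"
    and m: "\<And>z. z \<in> ball z0 s \<Longrightarrow> norm (S z - T z) \<le> m"
    and z: "z \<in> ball z0 s"
  shows "norm (S' z - T' z) \<le> m / 2"
proof -
  have m0: "0 \<le> m" using m[OF z] norm_ge_zero order_trans by blast
  have "norm ((S' z - T' z) - (S' z0 - T' z0)) \<le> s * (L * m)"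
  proof (rule curve_mean_value_bound[where d = "\<lambda>z. F (S z, z) - F (T z, z)"])
    fix x assume x: "x \<in> ball z0 s"
    show "((\<lambda>z. S' z - T' z) has_derivative (\<lambda>h. h *s (F (S x, x) - F (T x, x)))) (at x)"
      using has_derivative_diff[OF S'[OF x] T'[OF x]] by (simp add: vector_ssub_ldistrib)
    have "norm (F (S x, x) - F (T x, x)) \<le> L * norm (S x - T x)"
      using x s S T by (intro Lipschitz) (blast, blast, simp)
    also have "\<dots> \<le> L * m"
      by (rule mult_left_mono[OF m[OF x] L])
    finally show "norm (F (S x, x) - F (T x, x)) \<le> L * m" .
  qed (rule z)
  also have "\<dots> \<le> r * L * m"
    using s L m0 by (simp add: mult.assoc mult_right_mono)
  also have "\<dots> \<le> 1 / 2 * m"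
    by (rule mult_right_mono[OF rL m0])
  finally show ?thesis using eq by simp
qed

lemma picard_step:
  assumes S: "S holomorphic_curve_on ball z0 r" "S ` ball z0 r \<subseteq> cball w0 a"
  obtains T where "T z0 = w0"
    "\<And>z. z \<in> ball z0 r \<Longrightarrow> (T has_derivative (\<lambda>h. h *s F (S z, z))) (at z)"
    "T holomorphic_curve_on ball z0 r" "T ` ball z0 r \<subseteq> cball w0 a"
proof -
  have "\<exists>d. ((\<lambda>z. F (S z, z)) has_derivative (\<lambda>h. h *s d)) (at z)" if z: "z \<in> ball z0 r" for z
  proof -
    have "(S z, z) \<in> cball w0 a \<times> ball z0 r" using S(2) z by blast
    then obtain D where "(F has_derivative D) (at (S z, z))"
      "\<And>c v w. D (c *s v, c * w) = c *s D (v, w)"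
      using hol unfolding holomorphic_map_on_def by blast
    with has_derivative_map_along_curve[OF
        holomorphic_curve_has_derivative[OF S(1) open_ball z] DERIV_ident]
    show ?thesis by blast
  qed
  then obtain d where "\<And>z. z \<in> ball z0 r \<Longrightarrow>
      ((\<lambda>z. F (S z, z)) has_derivative (\<lambda>h. h *s d z)) (at z)"
    by metis
  then have "(\<lambda>z. F (S z, z)) holomorphic_curve_on ball z0 r"
    by (rule holomorphic_curve_onI)
  then obtain T where T: "T z0 = w0"
    "\<And>z. z \<in> ball z0 r \<Longrightarrow> (T has_derivative (\<lambda>h. h *s F (S z, z))) (at z)"
    using curve_primitive[of "\<lambda>z. F (S z, z)" "ball z0 r" z0 w0] by auto
  have "norm (T z - T z0) \<le> r * M" if "z \<in> ball z0 r" for z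
    using T(2) _ that by (rule curve_mean_value_bound) (use S(2) in \<open>auto intro!: bound\<close>)
  then have "T ` ball z0 r \<subseteq> cball w0 a"
    using rM T(1) by (force simp: dist_norm norm_minus_commute)
  moreover have "T holomorphic_curve_on ball z0 r"
    using T(2) by (rule holomorphic_curve_onI)
  ultimately show ?thesis
    using that T by blast
qed

lemma picard_existence:
  obtains S where "S z0 = w0" "S ` ball z0 r \<subseteq> cball w0 a"
    "\<And>z. z \<in> ball z0 r \<Longrightarrow> (S has_derivative (\<lambda>h. h *s F (S z, z))) (at z)"
proof -
  let ?B = "ball z0 r"
  define adm where "adm = (\<lambda>S. S holomorphic_curve_on ?B \<and> S ` ?B \<subseteq> cball w0 a \<and> S z0 = w0)"
  have "\<exists>T. \<forall>n. adm (T n) \<and> (\<forall>z\<in>?B. (T (Suc n) has_derivative (\<lambda>h. h *s F (T n z, z))) (at z))"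
  proof (rule dependent_nat_choice)
    show "\<exists>S. adm S"
      using a by (auto simp: adm_def holomorphic_curve_on_def intro!: exI[of _ "\<lambda>_. w0"])
    show "\<exists>T. adm T \<and> (\<forall>z\<in>?B. (T has_derivative (\<lambda>h. h *s F (S z, z))) (at z))"
      if "adm S" for S and n :: nat
      using picard_step[of S] that unfolding adm_def by metis
  qed
  then obtain T where T_adm: "\<And>n. adm (T n)"
    and T_deriv: "\<And>n z. z \<in> ?B \<Longrightarrow> (T (Suc n) has_derivative (\<lambda>h. h *s F (T n z, z))) (at z)"
    by metis
  have T0: "T n z0 = w0" for n
    using T_adm unfolding adm_def by blast
  have T_image: "T n ` ?B \<subseteq> cball w0 a" for n
    using T_adm unfolding adm_def by blast
  have T_in: "T n z \<in> cball w0 a" if "z \<in> ?B" for n z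
    using T_image that by blast
  \<comment> \<open>Contraction, started from the diameter \<open>2 * a\<close> of \<open>cball w0 a\<close>; uniform in \<open>k\<close>.\<close>
  have Cauchy_bound: "norm (T (n + k) z - T n z) \<le> 2 * a / 2 ^ n" if "z \<in> ?B" for n k z
    using that
  proof (induction n arbitrary: z)
    case 0
    have "norm (T k z - T 0 z) \<le> dist w0 (T k z) + dist w0 (T 0 z)"
      by (metis dist_norm dist_triangle2 dist_commute)
    then show ?case
      using T_in[OF 0, of k] T_in[OF 0, of 0] by simp
  next
    case (Suc n)
    have "norm (T (Suc (n + k)) z - T (Suc n) z) \<le> 2 * a / 2 ^ n / 2"
      by (rule picard_contraction[OF order_refl T_image T_image T_deriv T_deriv _ Suc.IH Suc.prems])
        (simp_all add: T0)
    then show ?case by simp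
  qed
  have small: "\<exists>n. 2 * a / 2 ^ n < e" if "0 < e" for e
    using real_arch_pow_inv[of "e / (2 * a)" "1 / 2"] that a
    by (auto simp: field_simps)
  have conv: "\<exists>l. (\<lambda>n. T n z) \<longlonglongrightarrow> l" if z: "z \<in> ?B" for z
  proof -
    have "Cauchy (\<lambda>n. T n z)"
    proof (rule metric_CauchyI)
      fix e :: real assume "0 < e"
      then obtain N where N: "2 * a / 2 ^ N < e / 2" using small[of "e / 2"] by auto
      have "dist (T N z) (T m z) < e / 2" if "N \<le> m" for m
        using Cauchy_bound[OF z, of N "m - N"] that N by (simp add: dist_norm norm_minus_commute)
      then show "\<exists>N. \<forall>m\<ge>N. \<forall>n\<ge>N. dist (T m z) (T n z) < e"
        using dist_triangle_half_r by blast
    qed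
    then show ?thesis
      using Cauchy_convergent_iff convergent_def by blast
  qed
  then obtain S where S_lim: "\<And>z. z \<in> ?B \<Longrightarrow> (\<lambda>n. T n z) \<longlonglongrightarrow> S z"
    by metis
  have S_in: "S z \<in> cball w0 a" if "z \<in> ?B" for z
    using closed_sequentially[OF closed_cball _ S_lim[OF that]] T_in[OF that] by blast
  have S_near: "norm (S z - T n z) \<le> 2 * a / 2 ^ n" if z: "z \<in> ?B" for n z
  proof (rule Lim_norm_ubound)
    show "((\<lambda>k. T (k + n) z - T n z) \<longlongrightarrow> S z - T n z) sequentially"
      by (intro tendsto_intros LIMSEQ_ignore_initial_segment S_lim z)
    show "\<forall>\<^sub>F k in sequentially. norm (T (k + n) z - T n z) \<le> 2 * a / 2 ^ n"
      using Cauchy_bound[OF z, of n] by (simp add: add.commute)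
  qed simp
  \<comment> \<open>The derivatives \<open>F (T n z, z)\<close> of the iterates converge uniformly to \<open>F (S z, z)\<close>.\<close>
  have "\<exists>g. \<forall>z\<in>?B. (\<lambda>n. T (Suc n) z) \<longlonglongrightarrow> g z \<and>
    (g has_derivative (\<lambda>h. h *s F (S z, z))) (at z within ?B)"
  proof (rule has_derivative_sequence)
    show "(T (Suc n) has_derivative (\<lambda>h. h *s F (T n z, z))) (at z within ?B)" if "z \<in> ?B" for n z
      using T_deriv[OF that] by (rule has_derivative_at_withinI)
    show "z0 \<in> ?B" using r by simp
    show "(\<lambda>n. T (Suc n) z0) \<longlonglongrightarrow> w0" by (simp add: T0)
    fix e :: real assume e: "0 < e"
    then obtain N where N: "2 * a / 2 ^ N < e / (L + 1)"
      using small[of "e / (L + 1)"] L by auto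
    show "\<forall>\<^sub>F n in sequentially. \<forall>z\<in>?B. \<forall>h.
      norm (h *s F (T n z, z) - h *s F (S z, z)) \<le> e * norm h"
    proof (rule eventually_sequentiallyI[of N], intro ballI allI)
      fix n z h assume n: "N \<le> n" and z: "z \<in> ?B"
      have "norm (T n z - S z) \<le> 2 * a / 2 ^ n"
        using S_near[OF z] by (simp add: norm_minus_commute)
      also have "\<dots> \<le> 2 * a / 2 ^ N"
        using n a by (intro divide_left_mono power_increasing) auto
      finally have near: "norm (T n z - S z) \<le> e / (L + 1)" using N by simp
      have "norm (F (T n z, z) - F (S z, z)) \<le> L * norm (T n z - S z)"
        by (rule Lipschitz[OF T_in[OF z] S_in[OF z] z])
      also have "\<dots> \<le> (L + 1) * (e / (L + 1))"
        using near L by (intro mult_mono) auto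
      finally have "norm (F (T n z, z) - F (S z, z)) \<le> e" using L by simp
      then show "norm (h *s F (T n z, z) - h *s F (S z, z)) \<le> e * norm h"
        by (simp add: norm_vector_scalar_mult mult_right_mono mult.commute[of e]
            mult_left_mono flip: vector_ssub_ldistrib)
    qed
  qed simp
  then obtain g where g_lim: "\<And>z. z \<in> ?B \<Longrightarrow> (\<lambda>n. T (Suc n) z) \<longlonglongrightarrow> g z"
    and g_deriv: "\<And>z. z \<in> ?B \<Longrightarrow> (g has_derivative (\<lambda>h. h *s F (S z, z))) (at z within ?B)"
    by blast
  have gS: "g z = S z" if "z \<in> ?B" for z
    using LIMSEQ_unique[OF g_lim[OF that]] LIMSEQ_Suc[OF S_lim[OF that]] by blast
  show ?thesis
  proof
    have "z0 \<in> ?B" using r by simp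
    from LIMSEQ_unique[OF g_lim[OF this]] show "g z0 = w0" by (simp add: T0)
    show "g ` ?B \<subseteq> cball w0 a" using S_in gS by auto
    show "(g has_derivative (\<lambda>h. h *s F (g z, z))) (at z)" if "z \<in> ?B" for z
      using g_deriv[OF that] gS[OF that] at_within_open[OF that open_ball] by simp
  qed
qed

lemma picard_uniqueness:
  assumes s: "s \<le> r"
    and S: "S ` ball z0 s \<subseteq> cball w0 a" and T: "T ` ball z0 s \<subseteq> cball w0 a"
    and S': "\<And>z. z \<in> ball z0 s \<Longrightarrow> (S has_derivative (\<lambda>h. h *s F (S z, z))) (at z)"
    and T': "\<And>z. z \<in> ball z0 s \<Longrightarrow> (T has_derivative (\<lambda>h. h *s F (T z, z))) (at z)"
    and eq: "S z0 = T z0" and z: "z \<in> ball z0 s"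
  shows "S z = T z"
proof -
  have le: "norm (S z - T z) \<le> 2 * a / 2 ^ k" if "z \<in> ball z0 s" for k z
    using that
  proof (induction k arbitrary: z)
    case 0
    have "norm (S z - T z) \<le> dist w0 (S z) + dist w0 (T z)"
      by (metis dist_norm dist_triangle2 dist_commute)
    then show ?case using S T 0 by (force simp: subset_iff)
  next
    case (Suc k)
    have "norm (S z - T z) \<le> 2 * a / 2 ^ k / 2"
      by (rule picard_contraction[OF s S T S' T' eq Suc.IH Suc.prems])
    then show ?case by simp
  qed
  have "(\<lambda>k. 2 * a / 2 ^ k) \<longlonglongrightarrow> 0"
    using tendsto_mult_right[OF LIMSEQ_inverse_realpow_zero[of 2], of "2 * a"]
    by (simp add: divide_inverse mult.commute)
  then have "norm (S z - T z) \<le> 0"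
    by (rule LIMSEQ_le_const) (use le[OF z] in blast)
  then show ?thesis by simp
qed

end

section \<open>Continuation up to the limit point\<close>

theorem theorem1:
  fixes V :: "complex set"
    and W :: "complex \<Rightarrow> complex ^ 'n"
    and F :: "(complex ^ 'n) \<times> complex \<Rightarrow> complex ^ 'n"
    and U :: "((complex ^ 'n) \<times> complex) set"
    and zs :: "nat \<Rightarrow> complex"
    and z_inf :: complex
    and W_inf :: "complex ^ 'n"
  assumes "open V" and "connected V"
    and "W holomorphic_curve_on V"
    and "open U" and "F holomorphic_map_on U"
    and "(\<lambda>z. (W z, z)) ` V \<subseteq> U"
    and "\<And>z. z \<in> V \<Longrightarrow> curve_deriv W z = F (W z, z)"
    and "z_inf \<in> frontier V"
    and "\<And>n. zs n \<in> V"
    and "zs \<longlonglongrightarrow> z_inf"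
    and "(\<lambda>n. W (zs n)) \<longlonglongrightarrow> W_inf"
    and "(W_inf, z_inf) \<in> U"
  shows "admits_analytic_continuation_up_to W V zs z_inf"
proof -
  obtain R M L where R: "0 < R" and M: "0 < M" and L: "0 < L" and RU: "cball (W_inf, z_inf) R \<subseteq> U"
    and bound: "\<And>q. q \<in> cball (W_inf, z_inf) R \<Longrightarrow> norm (F q) \<le> M"
    and Lip: "\<And>q q'. q \<in> cball (W_inf, z_inf) R \<Longrightarrow> q' \<in> cball (W_inf, z_inf) R \<Longrightarrow>
      norm (F q - F q') \<le> L * norm (q - q')"
    using holomorphic_map_locally_Lipschitz[OF assms(5,4,12)] by metis
  define a where "a = R / 4"
  \<comment> \<open>With this choice the cylinder at any \<open>(w0, z0)\<close> with \<open>dist w0 W_inf < R / 4\<close> and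
    \<open>dist z0 z_inf < r\<close> lies in the ball of radius \<open>R\<close>, and the hypotheses on \<open>r\<close> hold.\<close>
  define r where "r = min (R / 4) (min (a / M) (1 / (2 * L)))"
  have a: "0 < a" and r: "0 < r" "r \<le> R / 4" "r * M \<le> a" "r * L \<le> 1 / 2"
  proof -
    show "0 < a" using R by (simp add: a_def)
    then show "0 < r" using R M L by (simp add: r_def)
    show "r \<le> R / 4" unfolding r_def by (rule min.cobounded1)
    have "r \<le> a / M" "r \<le> 1 / (2 * L)"
      unfolding r_def by (meson min.cobounded1 min.cobounded2 order_trans)+
    then show "r * M \<le> a" "r * L \<le> 1 / 2" using M L by (simp_all add: field_simps)
  qed
  have "\<forall>\<^sub>F n in sequentially. dist (zs n) z_inf < r \<and> dist (W (zs n)) W_inf < R / 4"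
    using tendstoD[OF assms(10) r(1)] tendstoD[OF assms(11), of "R / 4"] R
    by (simp add: eventually_conj)
  then obtain n where zn: "dist (zs n) z_inf < r" and Wn: "dist (W (zs n)) W_inf < R / 4"
    by (auto simp: eventually_sequentially)
  define z0 where "z0 = zs n"
  define w0 where "w0 = W z0"
  have cyl: "(w, z) \<in> cball (W_inf, z_inf) R" if "w \<in> cball w0 a" "z \<in> ball z0 r" for w z
  proof -
    have "dist (w, z) (W_inf, z_inf) \<le> dist w W_inf + dist z z_inf"
      unfolding dist_Pair_Pair by (rule sqrt_sum_squares_le_sum) simp_all
    also have "dist w W_inf \<le> R / 2"
      using that(1) Wn dist_triangle[of w W_inf w0] by (simp add: a_def w0_def z0_def dist_commute)
    also have "dist z z_inf \<le> R / 2"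
      using that(2) zn r(2) dist_triangle[of z z_inf z0] by (simp add: z0_def dist_commute)
    finally show ?thesis by (simp add: dist_commute)
  qed
  interpret picard_cylinder F w0 z0 a r M L
  proof
    show "F holomorphic_map_on cball w0 a \<times> ball z0 r"
      using assms(5) cyl RU unfolding holomorphic_map_on_def by blast
    show "norm (F (w, z)) \<le> M" if "w \<in> cball w0 a" "z \<in> ball z0 r" for w z
      using bound cyl that by blast
    show "norm (F (w, z) - F (w', z)) \<le> L * norm (w - w')"
      if "w \<in> cball w0 a" "w' \<in> cball w0 a" "z \<in> ball z0 r" for w w' z
      using Lip[OF cyl[OF that(1,3)] cyl[OF that(2,3)]] by (simp add: norm_Pair)
  qed (use a r L in auto)
  obtain S where S: "S z0 = w0" "S ` ball z0 r \<subseteq> cball w0 a"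
    "\<And>z. z \<in> ball z0 r \<Longrightarrow> (S has_derivative (\<lambda>h. h *s F (S z, z))) (at z)"
    using picard_existence by metis
  have z0: "z0 \<in> V" using assms(9) by (simp add: z0_def)
  have W_deriv: "(W has_derivative (\<lambda>h. h *s F (W z, z))) (at z)" if "z \<in> V" for z
    using holomorphic_curve_has_derivative[OF assms(3,1) that] assms(7)[OF that] by simp
  \<comment> \<open>Uniqueness needs the values of \<open>W\<close> in \<open>cball w0 a\<close>, which continuity gives on a smaller disc.\<close>
  have "\<forall>\<^sub>F z in nhds z0. W z \<in> ball w0 a \<and> z \<in> V \<and> z \<in> ball z0 r"
  proof (intro eventually_conj)
    have "isCont W z0"
      using W_deriv[OF z0] by (rule has_derivative_continuous)
    then have "(W \<longlongrightarrow> w0) (nhds z0)"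
      by (simp add: continuous_at tendsto_at_iff_tendsto_nhds w0_def)
    then show "\<forall>\<^sub>F z in nhds z0. W z \<in> ball w0 a"
      by (rule topological_tendstoD) (use a in auto)
    show "\<forall>\<^sub>F z in nhds z0. z \<in> V"
      using assms(1) z0 by (rule eventually_nhds_in_open)
    show "\<forall>\<^sub>F z in nhds z0. z \<in> ball z0 r"
      using r(1) by (intro eventually_nhds_in_open) auto
  qed
  then obtain e where e: "0 < e"
    "\<And>z. z \<in> ball z0 e \<Longrightarrow> W z \<in> ball w0 a \<and> z \<in> V \<and> z \<in> ball z0 r"
    by (auto simp: eventually_nhds_metric dist_commute)
  define s where "s = min e r"
  have s: "0 < s" "s \<le> r" "ball z0 s \<subseteq> ball z0 e" "ball z0 s \<subseteq> ball z0 r"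
    using e(1) r(1) by (auto simp: s_def)
  have agree: "S z = W z" if "z \<in> ball z0 s" for z
  proof (rule picard_uniqueness[OF s(2) _ _ _ _ _ that])
    show "S ` ball z0 s \<subseteq> cball w0 a" using S(2) s(4) by blast
    show "W ` ball z0 s \<subseteq> cball w0 a" using e(2) s(3) by fastforce
    show "(S has_derivative (\<lambda>h. h *s F (S z, z))) (at z)" if "z \<in> ball z0 s" for z
      using S(3) s(4) that by blast
    show "(W has_derivative (\<lambda>h. h *s F (W z, z))) (at z)" if "z \<in> ball z0 s" for z
      using W_deriv e(2) s(3) that by blast
    show "S z0 = W z0" by (simp add: S(1) w0_def)
  qed
  show ?thesis
    unfolding admits_analytic_continuation_up_to_def
  proof (intro exI conjI)
    show "z_inf \<in> ball z0 r" "zs n \<in> ball z0 r"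
      using zn r(1) by (auto simp: z0_def)
    show "S holomorphic_curve_on ball z0 r"
      using S(3) by (rule holomorphic_curve_onI)
    show "open (ball z0 s)" "zs n \<in> ball z0 s"
      using s(1) by (auto simp: z0_def)
    show "ball z0 s \<subseteq> V \<inter> ball z0 r"
      using e(2) s(3,4) by blast
    show "\<forall>z\<in>ball z0 s. S z = W z"
      using agree by blast
  qed
qed

end
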